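(* Let $P\cup Q$ be a union of two disjoint monotonic $n$-cycles in $K_{2n}$ with $i$ interior edges each. Then the mean squared linking number of $P\cup Q$ in a random book embedding of $K_{2n}$ is $\frac{i}{6}$, that is, $$E\left[\ell(P\cup Q)^2\right]=\frac{i}{6}.$$
   Context: Circular diagram. The vertices $v_1,\dots,v_N$ of the complete graph $K_N$ (here $N=2n$) are placed at $N$ distinct points of a circle in clockwise order. Edges joining consecutive vertices $v_j,v_{j+1}$ (indices mod $N$) are called exterior edges and are drawn as arcs of the circle. The remaining $\binom{N}{2}-N$ edges are called interior edges and are projected to straight chords. Random book embedding. Each interior edge is placed on its own sheet (a disc bounded by the circle). The height order of the sheets is given by a uniformly random permutation $\sigma$ of $\{1,\dots,\binom N2-N\}$: interior edge $e_a$ lies above interior edge $e_b$ iff $\sigma(a)>\sigma(b)$. This determines an embedding of $K_N$ in $\mathbb{R}^3$ up to equivalence. The mean $E$ is taken with respect to $\sigma$, with $P$ and $Q$ fixed. Monotonic cycles. Cycles are simple cycles of length at least $3$. An oriented cycle with consecutive edges $\overrightarrow{v_{i_1}v_{i_2}},\dots,\overrightarrow{v_{i_{k-1}}v_{i_k}},\overrightarrow{v_{i_k}v_{i_1}}$ is strictly increasing (resp. strictly decreasing) if some cyclic permutation $i_1',\dots,i_k'$ of $i_1,\dots,i_k$ satisfies $i_j'<i_{j+1}'$ (resp. $i_j'>i_{j+1}'$) for all $1\le j\le k-1$. It is monotonic if it is strictly increasing or strictly decreasing. An unoriented cycle is monotonic if it is so for some (equivalently any) orientation. Two cycles are disjoint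 if they share no vertex. Linking number. For disjoint oriented cycles $P,Q$ and a given embedding, $\ell(P\cup Q)$ is half the sum of the signs of the crossings, in the circular diagram, between an edge of $P$ and an edge of $Q$ (two chords cross when they meet in their interiors; only interior edges can cross). A crossing has sign $+1$ if (direction of the over-edge, direction of the under-edge) is a positively oriented basis of the plane, and $-1$ otherwise. Reversing the orientation of one cycle changes the sign of $\ell(P\cup Q)$, so $\ell(P\cup Q)^2$ does not depend on orientations.
   Formalization: The case i = 1 is excluded, since the claim is false there: each cycle is then a block of consecutive vertices, the two interior edges do not cross, and the mean squared linking number is 0 rather than 1/6. *)

theory Defs
  imports "HOL-Probability.Probability" "HOL-Combinatorics.Permutations"
begin

text \<open>
  The vertices of \<open>K\<^sub>N\<close> are \<open>1, \<dots>, N\<close>; an unoriented edge is a two-element set of vertices.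
\<close>

definition edges :: "nat \<Rightarrow> nat set set" where
  "edges N = {{a, b} | a b. a \<in> {1..N} \<and> b \<in> {1..N} \<and> a \<noteq> b}"

definition exterior_edges :: "nat \<Rightarrow> nat set set" where
  "exterior_edges N = {{j, j mod N + 1} | j. j \<in> {1..N}}"

definition interior_edges :: "nat \<Rightarrow> nat set set" where
  "interior_edges N = edges N - exterior_edges N"

text \<open>
  The plane of the diagram is the complex plane. The strictly decreasing angles sweep less than a
  full turn, so the points are distinct and occur in clockwise order.
\<close>

definition clockwise_on_circle :: "nat \<Rightarrow> (nat \<Rightarrow> complex) \<Rightarrow> bool" where
  "clockwise_on_circle N p \<longleftrightarrow>
     (\<exists>(c::complex) (r::real) (\<theta>::nat \<Rightarrow> real). r > 0 \<and>
        (\<forall>j\<in>{1..N}. p j = c + of_real r * cis (\<theta> j)) \<and>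
        (\<forall>j\<in>{1..N}. \<forall>k\<in>{1..N}. j < k \<longrightarrow> \<theta> k < \<theta> j) \<and>
        \<theta> 1 - \<theta> N < 2 * pi)"

text \<open>
  An oriented cycle is given by the list of its vertices in order of traversal, from an arbitrary
  starting point; the same cycle with the opposite orientation is given by the reversed list.
\<close>

definition is_cycle :: "nat \<Rightarrow> nat list \<Rightarrow> bool" where
  "is_cycle N vs \<longleftrightarrow> 3 \<le> length vs \<and> distinct vs \<and> set vs \<subseteq> {1..N}"

definition strictly_increasing_cycle :: "nat list \<Rightarrow> bool" where
  "strictly_increasing_cycle vs \<longleftrightarrow> (\<exists>m. successively (<) (rotate m vs))"

definition strictly_decreasing_cycle :: "nat list \<Rightarrow> bool" where
  "strictly_decreasing_cycle vs \<longleftrightarrow> (\<exists>m. successively (>) (rotate m vs))"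

definition monotonic_cycle :: "nat list \<Rightarrow> bool" where
  "monotonic_cycle vs \<longleftrightarrow> strictly_increasing_cycle vs \<or> strictly_decreasing_cycle vs"

definition directed_edges :: "nat list \<Rightarrow> (nat \<times> nat) set" where
  "directed_edges vs = {(vs ! j, vs ! (Suc j mod length vs)) | j. j < length vs}"

definition interior_directed_edges :: "nat \<Rightarrow> nat list \<Rightarrow> (nat \<times> nat) set" where
  "interior_directed_edges N vs = {(a, b) \<in> directed_edges vs. {a, b} \<in> interior_edges N}"

definition crossings ::
  "nat \<Rightarrow> (nat \<Rightarrow> complex) \<Rightarrow> nat list \<Rightarrow> nat list \<Rightarrow> ((nat \<times> nat) \<times> (nat \<times> nat)) set" where
  "crossings N p P Q =
     {((a, b), (c, d)). (a, b) \<in> interior_directed_edges N P \<and> (c, d) \<in> interior_directed_edges N Q \<and>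
        open_segment (p a) (p b) \<inter> open_segment (p c) (p d) \<noteq> {}}"

definition positively_oriented :: "complex \<Rightarrow> complex \<Rightarrow> bool" where
  "positively_oriented u v \<longleftrightarrow> Re u * Im v - Im u * Re v > 0"

definition crossing_sign ::
  "(nat \<Rightarrow> complex) \<Rightarrow> (nat set \<Rightarrow> nat) \<Rightarrow> nat \<times> nat \<Rightarrow> nat \<times> nat \<Rightarrow> real" where
  "crossing_sign p h = (\<lambda>(a, b) (c, d).
     let (u, v) = (if h {a, b} > h {c, d} then (p b - p a, p d - p c) else (p d - p c, p b - p a))
     in if positively_oriented u v then 1 else -1)"

text \<open>
  A book embedding enters only through the height function \<open>h\<close> of the sheets carrying the
  interior edges.
\<close>

definition linking_number ::
  "nat \<Rightarrow> (nat \<Rightarrow> complex) \<Rightarrow> (nat set \<Rightarrow> nat) \<Rightarrow> nat list \<Rightarrow> nat list \<Rightarrow> real" where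
  "linking_number N p h P Q = (\<Sum>(x, y)\<in>crossings N p P Q. crossing_sign p h x y) / 2"

definition num_interior_edges :: "nat \<Rightarrow> nat" where
  "num_interior_edges N = (N choose 2) - N"

text \<open>
  For an enumeration \<open>e 1, \<dots>, e M\<close> of the interior edges, \<open>e a\<close> lies at height \<open>\<sigma> a\<close>.
\<close>

definition sheet_height :: "nat \<Rightarrow> (nat \<Rightarrow> nat set) \<Rightarrow> (nat \<Rightarrow> nat) \<Rightarrow> nat set \<Rightarrow> nat" where
  "sheet_height N e \<sigma> f = \<sigma> (inv_into {1..num_interior_edges N} e f)"

definition mean_squared_linking_number ::
  "nat \<Rightarrow> (nat \<Rightarrow> complex) \<Rightarrow> (nat \<Rightarrow> nat set) \<Rightarrow> nat list \<Rightarrow> nat list \<Rightarrow> real" where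
  "mean_squared_linking_number N p e P Q =
     measure_pmf.expectation (pmf_of_set {\<sigma>. \<sigma> permutes {1..num_interior_edges N}})
       (\<lambda>\<sigma>. (linking_number N p (sheet_height N e \<sigma>) P Q)\<^sup>2)"

end

theory Submission
  imports Defs
begin

text \<open>
  Fix the orientations so that both cycles run clockwise, and give every pair of an interior edge
  \<open>x\<close> of \<open>P\<close> and an interior edge \<open>y\<close> of \<open>Q\<close> the weight \<open>w x y \<in> {-1, 0, 1}\<close>: the sign of their
  crossing when \<open>x\<close> lies above \<open>y\<close>, and \<open>0\<close> when they do not cross. Exchanging the two sheets
  changes the sign, so \<open>2 * \<ell>(P \<union> Q)\<close> is the sum of the \<open>w x y\<close>, each multiplied by a random sign
  that compares the heights of \<open>x\<close> and \<open>y\<close> (\<open>linking_number_eq_weighted_sum\<close>).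

  The product of two of these random signs has mean \<open>1\<close> if they belong to the same pair, \<open>1/3\<close> if
  the pairs share exactly one edge, and \<open>0\<close> if they share none. Therefore the mean square of the
  sum is a third of the squared row sums of \<open>w\<close>, plus the squared column sums, plus the squared
  entries (\<open>second_moment_of_comparisons\<close>).

  An edge \<open>x\<close> cuts the circle into two arcs, and \<open>w x y\<close> is positive or negative according to
  whether \<open>y\<close> enters or leaves one of them. Since \<open>Q\<close> is closed, the rows of \<open>w\<close> add up to \<open>0\<close>
  (\<open>sum_arc_entry_cycle\<close>), and so do the columns. The arc that \<open>x\<close> skips contains only vertices
  of \<open>Q\<close>, which \<open>Q\<close> visits one after the other; hence exactly two edges of \<open>Q\<close> cross \<open>x\<close>, one
  on the way in and one on the way out (\<open>two_crossings_on_interior_edge\<close>). This is where a single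
  interior edge is an exception: then the arc contains all of \<open>Q\<close>, and nothing crosses. In total
  the squared entries add up to \<open>2 * i\<close>, and the mean of \<open>\<ell>(P \<union> Q)\<^sup>2\<close> is
  \<open>1/4 * 1/3 * (2 * i) = i / 6\<close>.
\<close>

section \<open>Uniformly random heights\<close>

definition permutation_mean :: "nat set \<Rightarrow> ((nat \<Rightarrow> nat) \<Rightarrow> real) \<Rightarrow> real" where
  "permutation_mean S F = measure_pmf.expectation (pmf_of_set {\<sigma>. \<sigma> permutes S}) F"

definition height_sign :: "(nat \<Rightarrow> nat) \<Rightarrow> nat \<Rightarrow> nat \<Rightarrow> real" where
  "height_sign \<sigma> j k = (if \<sigma> j > \<sigma> k then 1 else -1)"

lemma permutation_mean_eq_sum:
  assumes "finite S"
  shows "permutation_mean S F = (\<Sum>\<sigma> | \<sigma> permutes S. F \<sigma>) / card {\<sigma>. \<sigma> permutes S}"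
  unfolding permutation_mean_def
  by (intro integral_pmf_of_set) (use assms finite_permutations permutes_id in blast)+

lemma permutation_mean_const: "permutation_mean S (\<lambda>_. c) = c"
  unfolding permutation_mean_def by simp

lemma permutation_mean_sum:
  assumes "finite S"
  shows "permutation_mean S (\<lambda>\<sigma>. \<Sum>a\<in>A. F a \<sigma>) = (\<Sum>a\<in>A. permutation_mean S (F a))"
  unfolding permutation_mean_eq_sum[OF assms]
  by (subst sum.swap) (simp add: sum_divide_distrib)

lemma permutation_mean_cmult:
  assumes "finite S"
  shows "permutation_mean S (\<lambda>\<sigma>. c * F \<sigma>) = c * permutation_mean S F"
  unfolding permutation_mean_eq_sum[OF assms] by (simp add: sum_distrib_left)

lemma permutation_mean_transpose:
  assumes "finite S" "j \<in> S" "k \<in> S"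
  shows "permutation_mean S (\<lambda>\<sigma>. F (\<sigma> \<circ> Transposition.transpose j k)) = permutation_mean S F"
  unfolding permutation_mean_eq_sum[OF assms(1)]
  using sum_permutations_compose_right[OF permutes_swap_id[OF assms(2,3)], of F] by simp

lemma permutation_mean_cong:
  assumes "finite S" "\<And>\<sigma>. \<sigma> permutes S \<Longrightarrow> F \<sigma> = G \<sigma>"
  shows "permutation_mean S F = permutation_mean S G"
  unfolding permutation_mean_eq_sum[OF assms(1)]
  by (intro arg_cong2[where f = "(/)"] sum.cong refl) (use assms(2) in auto)

lemma height_sign_swap:
  assumes "\<sigma> permutes S" "j \<noteq> k"
  shows "height_sign \<sigma> k j = - height_sign \<sigma> j k"
proof -
  have "\<sigma> j \<noteq> \<sigma> k"
    using assms permutes_inj by (metis injD)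
  then show ?thesis
    by (auto simp: height_sign_def)
qed

lemma height_sign_square: "height_sign \<sigma> j k * height_sign \<sigma> j k = 1"
  by (simp add: height_sign_def)

text \<open>Exchanging \<open>j\<close> and \<open>k\<close> negates the first factor and leaves the second one alone.\<close>

lemma mean_height_sign_disjoint:
  assumes "finite S" "j \<in> S" "k \<in> S" "distinct [j, k, l, m]"
  shows "permutation_mean S (\<lambda>\<sigma>. height_sign \<sigma> j k * height_sign \<sigma> l m) = 0"
proof -
  let ?F = "\<lambda>\<sigma>. height_sign \<sigma> j k * height_sign \<sigma> l m"
  have "permutation_mean S ?F = permutation_mean S (\<lambda>\<sigma>. ?F (\<sigma> \<circ> Transposition.transpose j k))"
    using permutation_mean_transpose[OF assms(1-3), of ?F] by simp
  also have "\<dots> = permutation_mean S (\<lambda>\<sigma>. (-1) * ?F \<sigma>)"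
    using assms(4) by (intro permutation_mean_cong[OF assms(1)])
      (simp add: height_sign_def Transposition.transpose_def inj_eq[OF permutes_inj])
  also have "\<dots> = - permutation_mean S ?F"
    by (subst permutation_mean_cmult[OF assms(1)]) simp
  finally show ?thesis
    by simp
qed

text \<open>
  Among three distinct heights, the product of the two comparisons made at one of them is \<open>1\<close> at
  the top and at the bottom, and \<open>-1\<close> in the middle. The three products thus add up to \<open>1\<close>, and by
  symmetry they have the same mean.
\<close>

lemma mean_height_sign_common:
  assumes "finite S" "j \<in> S" "k \<in> S" "l \<in> S" "distinct [j, k, l]"
  shows "permutation_mean S (\<lambda>\<sigma>. height_sign \<sigma> j k * height_sign \<sigma> j l) = 1 / 3"
proof -
  define T where "T j k l = permutation_mean S (\<lambda>\<sigma>. height_sign \<sigma> j k * height_sign \<sigma> j l)" for j k l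
  have k: "T k j l = T j k l"
    unfolding T_def
    by (subst permutation_mean_transpose[OF assms(1-3), symmetric])
      (use assms(5) in \<open>simp add: height_sign_def Transposition.transpose_def\<close>)
  have l: "T l k j = T j k l"
    unfolding T_def
    by (subst permutation_mean_transpose[OF assms(1,2,4), symmetric])
      (use assms(5) in \<open>simp add: height_sign_def Transposition.transpose_def\<close>)
  define F where "F = (\<lambda>(a, b, c) \<sigma>. height_sign \<sigma> a b * height_sign \<sigma> a c)"
  have "permutation_mean S (\<lambda>\<sigma>. \<Sum>t\<in>{(j, k, l), (k, j, l), (l, k, j)}. F t \<sigma>)
      = permutation_mean S (\<lambda>_. 1)"
  proof (intro permutation_mean_cong[OF assms(1)])
    fix \<sigma> assume "\<sigma> permutes S"
    then have "\<sigma> j \<noteq> \<sigma> k" "\<sigma> j \<noteq> \<sigma> l" "\<sigma> k \<noteq> \<sigma> l"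
      using assms(5) by (auto simp: inj_eq[OF permutes_inj])
    then show "(\<Sum>t\<in>{(j, k, l), (k, j, l), (l, k, j)}. F t \<sigma>) = 1"
      using assms(5) by (auto simp: F_def height_sign_def)
  qed
  then have "(\<Sum>t\<in>{(j, k, l), (k, j, l), (l, k, j)}. permutation_mean S (F t)) = 1"
    by (simp add: permutation_mean_sum[OF assms(1)] permutation_mean_const)
  then have "T j k l + T k j l + T l k j = 1"
    using assms(5) by (simp add: F_def T_def)
  then show ?thesis
    using k l by (simp add: T_def)
qed

text \<open>
  The product of the signs of two pairs has mean \<open>1\<close> for the same pair, \<open>1/3\<close> for two pairs with one
  common member, \<open>0\<close> for two disjoint pairs. Writing this as a third of three indicators makes
  the second moment a sum of squares.
\<close>

lemma second_moment_of_comparisons: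
  fixes w :: "'a \<Rightarrow> 'b \<Rightarrow> real"
  assumes S: "finite S" and A: "finite A" and B: "finite B"
    and \<alpha>: "inj_on \<alpha> A" "\<alpha> ` A \<subseteq> S" and \<beta>: "inj_on \<beta> B" "\<beta> ` B \<subseteq> S"
    and disj: "\<alpha> ` A \<inter> \<beta> ` B = {}"
  shows "permutation_mean S (\<lambda>\<sigma>. (\<Sum>x\<in>A. \<Sum>y\<in>B. w x y * height_sign \<sigma> (\<alpha> x) (\<beta> y))\<^sup>2)
    = ((\<Sum>x\<in>A. (\<Sum>y\<in>B. w x y)\<^sup>2) + (\<Sum>y\<in>B. (\<Sum>x\<in>A. w x y)\<^sup>2) + (\<Sum>x\<in>A. \<Sum>y\<in>B. (w x y)\<^sup>2)) / 3"
proof -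
  let ?e = "\<lambda>x y \<sigma>. height_sign \<sigma> (\<alpha> x) (\<beta> y)"
  let ?k = "\<lambda>x y x' y'. (of_bool (x = x') + of_bool (y = y') + of_bool (x = x' \<and> y = y')) / 3 :: real"
  have mean: "permutation_mean S (\<lambda>\<sigma>. ?e x y \<sigma> * ?e x' y' \<sigma>) = ?k x y x' y'"
    if xy: "x \<in> A" "y \<in> B" "x' \<in> A" "y' \<in> B" for x y x' y'
  proof -
    have mem: "\<alpha> x \<in> S" "\<alpha> x' \<in> S" "\<beta> y \<in> S" "\<beta> y' \<in> S"
      using xy \<alpha>(2) \<beta>(2) by auto
    have ne: "\<alpha> x \<noteq> \<beta> y" "\<alpha> x \<noteq> \<beta> y'" "\<alpha> x' \<noteq> \<beta> y" "\<alpha> x' \<noteq> \<beta> y'"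
      using xy disj by blast+
    have eq: "\<alpha> x = \<alpha> x' \<longleftrightarrow> x = x'" "\<beta> y = \<beta> y' \<longleftrightarrow> y = y'"
      using xy \<alpha>(1) \<beta>(1) by (auto dest: inj_onD)
    consider "x = x'" "y = y'" | "x = x'" "y \<noteq> y'" | "x \<noteq> x'" "y = y'" | "x \<noteq> x'" "y \<noteq> y'"
      by blast
    then show ?thesis
    proof cases
      case 1
      then show ?thesis
        by (simp add: height_sign_square permutation_mean_const)
    next
      case 2
      then show ?thesis
        using mem ne eq mean_height_sign_common[OF S, of "\<alpha> x" "\<beta> y" "\<beta> y'"] by simp
    next
      case 3
      have "permutation_mean S (\<lambda>\<sigma>. ?e x y \<sigma> * ?e x' y \<sigma>)
          = permutation_mean S (\<lambda>\<sigma>. height_sign \<sigma> (\<beta> y) (\<alpha> x) * height_sign \<sigma> (\<beta> y) (\<alpha> x'))"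
        using ne by (intro permutation_mean_cong[OF S])
          (simp add: height_sign_swap[of _ S "\<alpha> x" "\<beta> y"] height_sign_swap[of _ S "\<alpha> x'" "\<beta> y"])
      then show ?thesis
        using 3 mem ne eq mean_height_sign_common[OF S, of "\<beta> y" "\<alpha> x" "\<alpha> x'"] by simp
    next
      case 4
      then show ?thesis
        using mem ne eq mean_height_sign_disjoint[OF S, of "\<alpha> x" "\<beta> y" "\<alpha> x'" "\<beta> y'"] by simp
    qed
  qed
  have "permutation_mean S (\<lambda>\<sigma>. (\<Sum>x\<in>A. \<Sum>y\<in>B. w x y * ?e x y \<sigma>)\<^sup>2)
      = permutation_mean S (\<lambda>\<sigma>. \<Sum>x\<in>A. \<Sum>y\<in>B. \<Sum>x'\<in>A. \<Sum>y'\<in>B. (w x y * w x' y') * (?e x y \<sigma> * ?e x' y' \<sigma>))"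
    by (simp only: power2_eq_square sum_distrib_right, simp only: sum_distrib_left mult_ac)
  also have "\<dots> = (\<Sum>x\<in>A. \<Sum>y\<in>B. \<Sum>x'\<in>A. \<Sum>y'\<in>B. (w x y * w x' y') * ?k x y x' y')"
    by (simp only: permutation_mean_sum[OF S] permutation_mean_cmult[OF S] mean cong: sum.cong)
  also have "\<dots> = ((\<Sum>x\<in>A. \<Sum>y\<in>B. \<Sum>x'\<in>A. \<Sum>y'\<in>B. w x y * w x' y' * of_bool (x = x'))
      + (\<Sum>x\<in>A. \<Sum>y\<in>B. \<Sum>x'\<in>A. \<Sum>y'\<in>B. w x y * w x' y' * of_bool (y = y'))
      + (\<Sum>x\<in>A. \<Sum>y\<in>B. \<Sum>x'\<in>A. \<Sum>y'\<in>B. w x y * w x' y' * of_bool (x = x' \<and> y = y'))) / 3"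
    by (simp add: sum.distrib sum_divide_distrib distrib_left add_divide_distrib)
  also have "(\<Sum>x\<in>A. \<Sum>y\<in>B. \<Sum>x'\<in>A. \<Sum>y'\<in>B. w x y * w x' y' * of_bool (x = x'))
      = (\<Sum>x\<in>A. (\<Sum>y\<in>B. w x y)\<^sup>2)"
  proof (rule sum.cong[OF refl])
    fix x assume "x \<in> A"
    then have "(\<Sum>x'\<in>A. \<Sum>y'\<in>B. w x y * w x' y' * of_bool (x = x')) = (\<Sum>y'\<in>B. w x y * w x y')" for y
      using A by (subst sum.swap) (simp add: of_bool_def if_distrib cong: if_cong)
    then show "(\<Sum>y\<in>B. \<Sum>x'\<in>A. \<Sum>y'\<in>B. w x y * w x' y' * of_bool (x = x')) = (\<Sum>y\<in>B. w x y)\<^sup>2"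
      by (simp add: power2_eq_square sum_product)
  qed
  also have "(\<Sum>x\<in>A. \<Sum>y\<in>B. \<Sum>x'\<in>A. \<Sum>y'\<in>B. w x y * w x' y' * of_bool (y = y'))
      = (\<Sum>y\<in>B. (\<Sum>x\<in>A. w x y)\<^sup>2)"
  proof (subst sum.swap, rule sum.cong[OF refl])
    fix y assume "y \<in> B"
    then have "(\<Sum>x'\<in>A. \<Sum>y'\<in>B. w x y * w x' y' * of_bool (y = y')) = (\<Sum>x'\<in>A. w x y * w x' y)" for x
      using B by (simp add: of_bool_def if_distrib cong: if_cong)
    then show "(\<Sum>x\<in>A. \<Sum>x'\<in>A. \<Sum>y'\<in>B. w x y * w x' y' * of_bool (y = y')) = (\<Sum>x\<in>A. w x y)\<^sup>2"
      by (simp add: power2_eq_square sum_product)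
  qed
  also have "(\<Sum>x\<in>A. \<Sum>y\<in>B. \<Sum>x'\<in>A. \<Sum>y'\<in>B. w x y * w x' y' * of_bool (x = x' \<and> y = y'))
      = (\<Sum>x\<in>A. \<Sum>y\<in>B. (w x y)\<^sup>2)"
  proof (intro sum.cong refl)
    fix x y assume "x \<in> A" "y \<in> B"
    then have "(\<Sum>y'\<in>B. w x y * w x' y' * of_bool (x = x' \<and> y = y'))
        = (if x = x' then w x y * w x y else 0)" for x'
      using B by (simp add: of_bool_def if_distrib cong: if_cong)
    then show "(\<Sum>x'\<in>A. \<Sum>y'\<in>B. w x y * w x' y' * of_bool (x = x' \<and> y = y')) = (w x y)\<^sup>2"
      using A \<open>x \<in> A\<close> by (simp add: power2_eq_square)
  qed
  finally show ?thesis .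
qed

section \<open>Crossings of chords of a circle\<close>

definition clockwise_between :: "nat \<Rightarrow> nat \<Rightarrow> nat \<Rightarrow> bool" where
  "clockwise_between a v b \<longleftrightarrow> a < v \<and> v < b \<or> v < b \<and> b < a \<or> b < a \<and> a < v"

lemma clockwise_between_trans:
  assumes "clockwise_between a u v" "clockwise_between a v b"
  shows "clockwise_between a u b"
  using assms unfolding clockwise_between_def
  by (smt (verit) less_trans linorder_neqE_nat less_irrefl)

lemma clockwise_between_rotate: "clockwise_between a v b \<longleftrightarrow> clockwise_between v b a"
  unfolding clockwise_between_def by blast

lemma clockwise_between_total:
  assumes "u \<noteq> a" "v \<noteq> a" "u \<noteq> v"
  shows "clockwise_between a u v \<or> clockwise_between a v u"
  using assms unfolding clockwise_between_def
  by (smt (verit) less_trans linorder_neqE_nat less_irrefl)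

lemma clockwise_between_reverse:
  assumes "a \<noteq> b" "v \<noteq> a" "v \<noteq> b"
  shows "clockwise_between b v a \<longleftrightarrow> \<not> clockwise_between a v b"
  using assms unfolding clockwise_between_def
  by (smt (verit) less_trans linorder_neqE_nat less_irrefl)

lemma clockwise_between_outside:
  assumes "clockwise_between a v b" "\<not> clockwise_between a w b"
  shows "w \<noteq> b \<Longrightarrow> clockwise_between v b w" and "w \<noteq> a \<Longrightarrow> clockwise_between w a v"
  using assms unfolding clockwise_between_def
  by (smt (verit) less_trans linorder_neqE_nat less_irrefl)+

lemma clockwise_between_exit:
  assumes "clockwise_between a u v" "clockwise_between a v b" "\<not> clockwise_between a w b"
  shows "clockwise_between u v w"
  using assms unfolding clockwise_between_def
  by (smt (verit) less_trans linorder_neqE_nat less_irrefl)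

text \<open>An endpoint of one arc that is not shared separates \<open>w\<close> from an endpoint of the other.\<close>

lemma meeting_arcs_equal:
  assumes "clockwise_between a w b" "clockwise_between a' w b'"
    and "\<not> clockwise_between a a' b" "\<not> clockwise_between a b' b"
    and "\<not> clockwise_between a' a b'" "\<not> clockwise_between a' b b'"
  shows "a = a' \<and> b = b'"
proof (rule conjI; rule ccontr)
  assume "a \<noteq> a'"
  then have "clockwise_between a' a w"
    using clockwise_between_outside(2)[OF assms(1,3)] by simp
  then show False
    using clockwise_between_trans assms(2,5) by blast
next
  assume "b \<noteq> b'"
  then have "clockwise_between w b b'"
    using clockwise_between_outside(1)[OF assms(1,4)] by simp
  then show False
    using clockwise_between_trans[of b' a' w b] assms(2,6) clockwise_between_rotate by blast
qed

text \<open>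
  The chord \<open>c \<rightarrow> d\<close> counts \<open>1\<close> if it enters the clockwise open arc from \<open>a\<close> to \<open>b\<close>, and \<open>-1\<close> if it
  leaves it. This is the sign of its crossing with \<open>a \<rightarrow> b\<close> when \<open>a \<rightarrow> b\<close> lies on top.
\<close>

definition arc_entry :: "nat \<times> nat \<Rightarrow> nat \<times> nat \<Rightarrow> real" where
  "arc_entry = (\<lambda>(a, b) (c, d).
     of_bool (clockwise_between a d b) - of_bool (clockwise_between a c b))"

lemma clockwise_between_alternate:
  assumes "distinct [a, b, c, d]"
  shows "clockwise_between a c b \<and> \<not> clockwise_between a d b \<longleftrightarrow>
    clockwise_between c b d \<and> \<not> clockwise_between c a d"
proof
  assume "clockwise_between a c b \<and> \<not> clockwise_between a d b"
  then show "clockwise_between c b d \<and> \<not> clockwise_between c a d"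
    using clockwise_between_outside[of a c b d] clockwise_between_reverse[of c d a] assms by auto
next
  assume "clockwise_between c b d \<and> \<not> clockwise_between c a d"
  then show "clockwise_between a c b \<and> \<not> clockwise_between a d b"
    using clockwise_between_outside[of c b d a] clockwise_between_reverse[of a b d] assms by auto
qed

lemma arc_entry_reverse:
  assumes "distinct [a, b, c, d]"
  shows "arc_entry (b, a) (c, d) = - arc_entry (a, b) (c, d)"
    and "arc_entry (a, b) (d, c) = - arc_entry (a, b) (c, d)"
  using assms by (simp_all add: arc_entry_def clockwise_between_reverse[of a b])

lemma arc_entry_swap:
  assumes "distinct [a, b, c, d]"
  shows "arc_entry (c, d) (a, b) = - arc_entry (a, b) (c, d)"
proof -
  have "distinct [a, b, d, c]"
    using assms by auto
  from clockwise_between_alternate[OF assms] clockwise_between_alternate[OF this]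
  show ?thesis
    using assms clockwise_between_reverse[of c d a] clockwise_between_reverse[of c d b]
    by (cases "clockwise_between a c b"; cases "clockwise_between a d b") (auto simp: arc_entry_def)
qed

definition planar_det :: "complex \<Rightarrow> complex \<Rightarrow> real" where
  "planar_det u v = Re u * Im v - Im u * Re v"

lemma positively_oriented_iff: "positively_oriented u v \<longleftrightarrow> planar_det u v > 0"
  by (simp add: positively_oriented_def planar_det_def)

text \<open>
  The determinant is twice the signed area of a triangle inscribed in the unit circle. Each sine is
  half the length of a side, up to sign, so this is the formula for the area in terms of the sides
  and the circumradius.
\<close>

lemma planar_det_inscribed_triangle:
  "planar_det (cis \<beta> - cis \<alpha>) (cis \<gamma> - cis \<alpha>)
    = 4 * sin ((\<beta> - \<alpha>) / 2) * sin ((\<gamma> - \<beta>) / 2) * sin ((\<gamma> - \<alpha>) / 2)"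
proof -
  have ident: "sin (2 * x) + sin (2 * y) - sin (2 * x + 2 * y) = 4 * sin x * sin y * sin (x + y)"
    for x y :: real
  proof -
    have "sin (2 * x) + sin (2 * y) - sin (2 * x + 2 * y)
        = sin (2 * x) * (1 - cos (2 * y)) + sin (2 * y) * (1 - cos (2 * x))"
      by (simp add: sin_add algebra_simps)
    also have "\<dots> = 4 * sin x * sin y * sin (x + y)"
      unfolding cos_double_sin sin_double sin_add by (simp add: power2_eq_square algebra_simps)
    finally show ?thesis .
  qed
  have "planar_det (cis \<beta> - cis \<alpha>) (cis \<gamma> - cis \<alpha>) = sin (\<beta> - \<alpha>) + sin (\<gamma> - \<beta>) - sin (\<gamma> - \<alpha>)"
    by (simp add: planar_det_def sin_diff algebra_simps)
  also have "\<dots> = 4 * sin ((\<beta> - \<alpha>) / 2) * sin ((\<gamma> - \<beta>) / 2) * sin ((\<gamma> - \<alpha>) / 2)"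
    using ident[of "(\<beta> - \<alpha>) / 2" "(\<gamma> - \<beta>) / 2"] by (simp add: diff_divide_distrib)
  finally show ?thesis .
qed

text \<open>
  The half angles between points of the diagram lie in \<open>(-\<pi>, \<pi>)\<close>, so the three sines in the
  determinant of an inscribed triangle have the signs of the differences of the indices.
\<close>

lemma left_of_chord_iff:
  assumes circle: "clockwise_on_circle N p"
    and abv: "a \<in> {1..N}" "b \<in> {1..N}" "v \<in> {1..N}" "distinct [a, b, v]"
  shows "planar_det (p b - p a) (p v - p a) > 0 \<longleftrightarrow> clockwise_between a v b"
    and "planar_det (p b - p a) (p v - p a) < 0 \<longleftrightarrow> \<not> clockwise_between a v b"
proof -
  obtain c r \<theta> where r: "r > 0"
    and p: "\<And>j. j \<in> {1..N} \<Longrightarrow> p j = c + of_real r * cis (\<theta> j)"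
    and dec: "\<And>j k. j \<in> {1..N} \<Longrightarrow> k \<in> {1..N} \<Longrightarrow> j < k \<Longrightarrow> \<theta> k < \<theta> j"
    and turn: "\<theta> 1 - \<theta> N < 2 * pi"
    using circle unfolding clockwise_on_circle_def by blast
  define s where "s j k = sin ((\<theta> k - \<theta> j) / 2)" for j k
  have s_sym: "s k j = - s j k" for j k
    unfolding s_def by (subst sin_minus[symmetric]) (simp add: minus_divide_left)
  have s_neg: "s j k < 0" if jk: "j \<in> {1..N}" "k \<in> {1..N}" "j < k" for j k
  proof -
    have "\<theta> N \<le> \<theta> k" "\<theta> j \<le> \<theta> 1"
      using jk dec[of k N] dec[of 1 j] by (cases "k = N"; cases "j = 1"; force)+
    then have "0 < sin ((\<theta> j - \<theta> k) / 2)"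
      using dec[OF jk] turn by (intro sin_gt_zero) auto
    then show ?thesis
      using s_sym[of j k] by (simp add: s_def)
  qed
  have s_pos: "s j k > 0" if "j \<in> {1..N}" "k \<in> {1..N}" "k < j" for j k
    using s_neg[of k j] s_sym[of k j] that by simp
  have scale: "planar_det (of_real r * u) (of_real r * v) = r\<^sup>2 * planar_det u v" for u v
    by (simp add: planar_det_def power2_eq_square algebra_simps)
  have "planar_det (p b - p a) (p v - p a)
      = planar_det (of_real r * (cis (\<theta> b) - cis (\<theta> a))) (of_real r * (cis (\<theta> v) - cis (\<theta> a)))"
    using abv by (simp add: p algebra_simps)
  also have "\<dots> = 4 * r\<^sup>2 * (s a b * s b v * s a v)"
    unfolding scale planar_det_inscribed_triangle s_def by simp
  finally have det: "planar_det (p b - p a) (p v - p a) = 4 * r\<^sup>2 * (s a b * s b v * s a v)" .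
  have sgn: "s a b < 0 \<longleftrightarrow> a < b" "s a b > 0 \<longleftrightarrow> b < a" "s b v < 0 \<longleftrightarrow> b < v"
    "s b v > 0 \<longleftrightarrow> v < b" "s a v < 0 \<longleftrightarrow> a < v" "s a v > 0 \<longleftrightarrow> v < a"
    using abv s_neg s_pos by (metis distinct_length_2_or_more linorder_neqE_nat order_less_asym)+
  show "planar_det (p b - p a) (p v - p a) > 0 \<longleftrightarrow> clockwise_between a v b"
    using r abv(4) unfolding det clockwise_between_def
    by (auto simp: zero_less_mult_iff mult_less_0_iff sgn)
  show "planar_det (p b - p a) (p v - p a) < 0 \<longleftrightarrow> \<not> clockwise_between a v b"
    using r abv(4) unfolding det clockwise_between_def
    by (auto simp: zero_less_mult_iff mult_less_0_iff sgn)
qed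

text \<open>
  A common point lies on the line through \<open>a\<close> and \<open>b\<close>, and strictly between \<open>c\<close> and \<open>d\<close>, which
  forces \<open>c\<close> and \<open>d\<close> to opposite sides of that line.
\<close>

lemma segments_meet_imp_opposite_sides:
  assumes "open_segment a b \<inter> open_segment c d \<noteq> {}"
    and "planar_det (b - a) (c - a) \<noteq> 0"
  shows "planar_det (b - a) (c - a) * planar_det (b - a) (d - a) < 0"
proof -
  obtain t u where u: "0 < u" "u < 1"
    and eq: "(1 - t) *\<^sub>R a + t *\<^sub>R b = (1 - u) *\<^sub>R c + u *\<^sub>R d"
    using assms(1) by (auto simp: in_segment)
  have "Re (c + u *\<^sub>R (d - c)) = Re (a + t *\<^sub>R (b - a))" "Im (c + u *\<^sub>R (d - c)) = Im (a + t *\<^sub>R (b - a))"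
    using arg_cong[OF eq, of Re] arg_cong[OF eq, of Im] by (simp_all add: algebra_simps)
  then have re: "Re c - Re a = t * (Re b - Re a) - u * (Re d - Re c)"
    and im: "Im c - Im a = t * (Im b - Im a) - u * (Im d - Im c)"
    by simp_all
  have "(1 - u) * planar_det (b - a) (c - a) + u * planar_det (b - a) (d - a)
      = (Re b - Re a) * ((Im c - Im a) + u * (Im d - Im c))
        - (Im b - Im a) * ((Re c - Re a) + u * (Re d - Re c))"
    by (simp add: planar_det_def algebra_simps)
  also have "\<dots> = 0"
    unfolding re im by (simp add: algebra_simps)
  finally have weighted: "u * planar_det (b - a) (d - a) = - ((1 - u) * planar_det (b - a) (c - a))"
    by (simp add: algebra_simps)
  have "u * (planar_det (b - a) (c - a) * planar_det (b - a) (d - a))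
      = planar_det (b - a) (c - a) * (u * planar_det (b - a) (d - a))"
    by simp
  also have "\<dots> = - ((1 - u) * (planar_det (b - a) (c - a))\<^sup>2)"
    unfolding weighted by (simp add: power2_eq_square)
  also have "\<dots> < 0"
    using u assms(2) by simp
  finally show ?thesis
    using u by (simp add: mult_less_0_iff)
qed

text \<open>
  Conversely, Cramer's rule gives the intersection of the two lines, and the side conditions place
  it strictly inside both segments.
\<close>

lemma opposite_sides_imp_segments_meet:
  assumes cd: "planar_det (b - a) (c - a) * planar_det (b - a) (d - a) < 0"
    and ab: "planar_det (d - c) (a - c) * planar_det (d - c) (b - c) < 0"
  shows "open_segment a b \<inter> open_segment c d \<noteq> {}"
proof -
  define D where "D = planar_det (b - a) (d - c)"
  define u where "u = - planar_det (b - a) (c - a) / D"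
  define t where "t = planar_det (d - c) (a - c) / D"
  have between: "0 < x / (x - y) \<and> x / (x - y) < 1"
    and between': "0 < - x / (y - x) \<and> - x / (y - x) < 1" if "x * y < 0" for x y :: real
    using that by (auto simp: mult_less_0_iff divide_simps)
  have D_cd: "D = planar_det (b - a) (d - a) - planar_det (b - a) (c - a)"
    by (simp add: D_def planar_det_def algebra_simps)
  have D_ab: "D = planar_det (d - c) (a - c) - planar_det (d - c) (b - c)"
    by (simp add: D_def planar_det_def algebra_simps)
  have t: "0 < t" "t < 1"
    using between[OF ab] unfolding t_def D_ab by auto
  have u: "0 < u" "u < 1"
    using between'[OF cd] unfolding u_def D_cd by auto
  have D: "D \<noteq> 0"
    using t(1) by (auto simp: t_def)
  have "D *\<^sub>R a + (t * D) *\<^sub>R (b - a) = D *\<^sub>R c + (u * D) *\<^sub>R (d - c)"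
    using D by (simp add: t_def u_def) (simp add: complex_eq_iff D_def planar_det_def algebra_simps)
  then have "D *\<^sub>R (a + t *\<^sub>R (b - a)) = D *\<^sub>R (c + u *\<^sub>R (d - c))"
    by (simp add: algebra_simps)
  then have "a + t *\<^sub>R (b - a) = c + u *\<^sub>R (d - c)"
    using D by simp
  then have eq: "(1 - t) *\<^sub>R a + t *\<^sub>R b = (1 - u) *\<^sub>R c + u *\<^sub>R d"
    by (simp add: algebra_simps)
  have "a \<noteq> b" "c \<noteq> d"
    using D by (auto simp: D_def planar_det_def)
  then have "(1 - t) *\<^sub>R a + t *\<^sub>R b \<in> open_segment a b" "(1 - t) *\<^sub>R a + t *\<^sub>R b \<in> open_segment c d"
    using t u unfolding eq by (auto simp: in_segment simp flip: eq)
  then show ?thesis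
    by blast
qed

lemma chords_meet_iff:
  assumes circle: "clockwise_on_circle N p"
    and abcd: "{a, b, c, d} \<subseteq> {1..N}" "distinct [a, b, c, d]"
  shows "open_segment (p a) (p b) \<inter> open_segment (p c) (p d) \<noteq> {} \<longleftrightarrow> arc_entry (a, b) (c, d) \<noteq> 0"
proof -
  note side = left_of_chord_iff[OF circle]
  have entry: "arc_entry (a, b) (c, d) \<noteq> 0 \<longleftrightarrow> clockwise_between a c b \<noteq> clockwise_between a d b"
    by (auto simp: arc_entry_def)
  have alternate: "clockwise_between a c b \<noteq> clockwise_between a d b \<longleftrightarrow>
      clockwise_between c a d \<noteq> clockwise_between c b d"
    using arc_entry_swap[OF abcd(2)] by (auto simp: arc_entry_def of_bool_def split: if_splits)
  have cd: "planar_det (p b - p a) (p c - p a) * planar_det (p b - p a) (p d - p a) < 0 \<longleftrightarrow>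
      clockwise_between a c b \<noteq> clockwise_between a d b"
    using abcd side[of a b c] side[of a b d] by (simp add: mult_less_0_iff) blast
  have ab: "planar_det (p d - p c) (p a - p c) * planar_det (p d - p c) (p b - p c) < 0 \<longleftrightarrow>
      clockwise_between c a d \<noteq> clockwise_between c b d"
    using abcd side[of c d a] side[of c d b] by (simp add: mult_less_0_iff) blast
  have nonzero: "planar_det (p b - p a) (p c - p a) \<noteq> 0"
    using abcd side[of a b c] by (cases "clockwise_between a c b") auto
  show ?thesis
  proof
    assume "open_segment (p a) (p b) \<inter> open_segment (p c) (p d) \<noteq> {}"
    from segments_meet_imp_opposite_sides[OF this nonzero]
    show "arc_entry (a, b) (c, d) \<noteq> 0"
      unfolding entry cd .
  next
    assume "arc_entry (a, b) (c, d) \<noteq> 0"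
    then have cd_ne: "clockwise_between a c b \<noteq> clockwise_between a d b"
      unfolding entry .
    then have ab_ne: "clockwise_between c a d \<noteq> clockwise_between c b d"
      unfolding alternate .
    show "open_segment (p a) (p b) \<inter> open_segment (p c) (p d) \<noteq> {}"
      by (rule opposite_sides_imp_segments_meet[OF cd[THEN iffD2, OF cd_ne] ab[THEN iffD2, OF ab_ne]])
  qed
qed

lemma crossing_sign_eq:
  assumes circle: "clockwise_on_circle N p"
    and abcd: "{a, b, c, d} \<subseteq> {1..N}" "distinct [a, b, c, d]" "arc_entry (a, b) (c, d) \<noteq> 0"
  shows "crossing_sign p h (a, b) (c, d)
    = arc_entry (a, b) (c, d) * (if h {a, b} > h {c, d} then 1 else -1)"
proof -
  note side = left_of_chord_iff[OF circle, of a b]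
  have split: "planar_det (p b - p a) (p d - p c)
      = planar_det (p b - p a) (p d - p a) - planar_det (p b - p a) (p c - p a)"
    by (simp add: planar_det_def algebra_simps)
  have anti: "planar_det (p d - p c) (p b - p a) = - planar_det (p b - p a) (p d - p c)"
    by (simp add: planar_det_def algebra_simps)
  consider "clockwise_between a d b" "\<not> clockwise_between a c b"
    | "\<not> clockwise_between a d b" "clockwise_between a c b"
    using abcd(3) by (auto simp: arc_entry_def of_bool_def split: if_splits)
  then show ?thesis
  proof cases
    case 1
    then have "planar_det (p b - p a) (p d - p c) > 0"
      using abcd side[of c] side[of d] unfolding split by auto
    then show ?thesis
      using 1 anti by (simp add: crossing_sign_def positively_oriented_iff arc_entry_def)
  next
    case 2
    then have "planar_det (p b - p a) (p d - p c) < 0"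
      using abcd side[of c] side[of d] unfolding split by auto
    then show ?thesis
      using 2 anti by (simp add: crossing_sign_def positively_oriented_iff arc_entry_def)
  qed
qed

section \<open>Directed edges of a cycle\<close>

lemma bij_betw_Suc_mod:
  assumes "n > 0"
  shows "bij_betw (\<lambda>j. Suc j mod n) {..<n} {..<n}"
proof -
  have "inj_on (\<lambda>j. Suc j mod n) {..<n}"
    by (auto simp: inj_on_def mod_Suc split: if_splits)
  moreover have "(\<lambda>j. Suc j mod n) ` {..<n} \<subseteq> {..<n}"
    using assms by auto
  ultimately show ?thesis
    by (simp add: bij_betw_def endo_inj_surj)
qed

lemma directed_edges_eq_image:
  "directed_edges vs = (\<lambda>j. (vs ! j, vs ! (Suc j mod length vs))) ` {..<length vs}"
  by (auto simp: directed_edges_def)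

lemma finite_directed_edges: "finite (directed_edges vs)"
  by (simp add: directed_edges_eq_image)

lemma finite_interior_directed_edges: "finite (interior_directed_edges N vs)"
  by (rule finite_subset[OF _ finite_directed_edges[of vs]]) (auto simp: interior_directed_edges_def)

lemma directed_edges_rotate: "directed_edges (rotate m vs) = directed_edges vs"
proof (induction m)
  case (Suc m)
  have "directed_edges (rotate1 ws) = directed_edges ws" for ws :: "nat list"
  proof (cases "ws = []")
    case False
    let ?n = "length ws"
    have "directed_edges (rotate1 ws)
        = (\<lambda>j. (ws ! j, ws ! (Suc j mod ?n))) ` (\<lambda>j. Suc j mod ?n) ` {..<?n}"
      using False unfolding directed_edges_eq_image image_image
      by (intro image_cong) (simp_all add: nth_rotate1)
    then show ?thesis
      using bij_betw_Suc_mod[of ?n] False by (simp add: directed_edges_eq_image bij_betw_def)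
  qed simp
  then show ?case
    using Suc by simp
qed simp

lemma directed_edges_rev: "directed_edges (rev vs) = (directed_edges vs)\<inverse>"
proof -
  have sub: "directed_edges (rev ws) \<subseteq> (directed_edges ws)\<inverse>" for ws :: "nat list"
  proof
    fix x assume "x \<in> directed_edges (rev ws)"
    then obtain j where j: "j < length ws" and x: "x = (rev ws ! j, rev ws ! (Suc j mod length ws))"
      by (auto simp: directed_edges_def)
    define k where "k = length ws - Suc (Suc j mod length ws)"
    have "k < length ws" "Suc k mod length ws = length ws - Suc j"
      using j by (auto simp: k_def mod_Suc)
    moreover have "Suc j mod length ws < length ws"
      using j by (intro mod_less_divisor) linarith
    then have "rev ws ! j = ws ! (length ws - Suc j)" "rev ws ! (Suc j mod length ws) = ws ! k"
      using j by (simp_all add: rev_nth k_def)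
    ultimately show "x \<in> (directed_edges ws)\<inverse>"
      unfolding x by (auto simp: directed_edges_def intro!: exI[of _ k])
  qed
  from sub[of vs] sub[of "rev vs"] show ?thesis
    by auto
qed

lemma directed_edge_vertices:
  assumes "(a, b) \<in> directed_edges vs" "distinct vs" "3 \<le> length vs"
  shows "a \<in> set vs" "b \<in> set vs" "a \<noteq> b"
proof -
  obtain j where j: "j < length vs" "a = vs ! j" "b = vs ! (Suc j mod length vs)"
    using assms(1) by (auto simp: directed_edges_def)
  have "Suc j mod length vs < length vs" "Suc j mod length vs \<noteq> j"
    using j(1) assms(3) by (auto simp: mod_Suc)
  then show "a \<in> set vs" "b \<in> set vs" "a \<noteq> b"
    using j assms(2) by (auto simp: nth_eq_iff_index_eq)
qed

lemma directed_edge_out_unique: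
  assumes "(a, b) \<in> directed_edges vs" "(a, b') \<in> directed_edges vs" "distinct vs"
  shows "b = b'"
  using assms by (auto simp: directed_edges_def nth_eq_iff_index_eq)

text \<open>A telescoping sum.\<close>

lemma sum_increments_cycle:
  fixes f :: "nat \<Rightarrow> real"
  assumes "distinct vs"
  shows "(\<Sum>(c, d)\<in>directed_edges vs. f d - f c) = 0"
proof (cases "vs = []")
  case False
  let ?n = "length vs"
  have "inj_on (\<lambda>j. (vs ! j, vs ! (Suc j mod ?n))) {..<?n}"
    using assms by (auto simp: inj_on_def nth_eq_iff_index_eq)
  then have "(\<Sum>(c, d)\<in>directed_edges vs. f d - f c) = (\<Sum>j<?n. f (vs ! (Suc j mod ?n)) - f (vs ! j))"
    unfolding directed_edges_eq_image by (subst sum.reindex) simp_all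
  also have "\<dots> = 0"
    using sum.reindex_bij_betw[OF bij_betw_Suc_mod[of ?n], of "\<lambda>j. f (vs ! j)"] False
    by (simp add: sum_subtractf)
  finally show ?thesis .
qed (simp add: directed_edges_def)

lemma cycle_leaves_set:
  assumes "v \<in> set vs" "v \<in> J" "w \<in> set vs" "w \<notin> J"
  obtains c d where "(c, d) \<in> directed_edges vs" "c \<in> J" "d \<notin> J"
proof -
  let ?n = "length vs"
  obtain j k where j: "j < ?n" "v = vs ! j" and k: "k < ?n" "w = vs ! k"
    using assms by (auto simp: in_set_conv_nth)
  have "\<exists>c d. (c, d) \<in> directed_edges vs \<and> c \<in> J \<and> d \<notin> J"
  proof (rule ccontr)
    assume closed: "\<nexists>c d. (c, d) \<in> directed_edges vs \<and> c \<in> J \<and> d \<notin> J"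
    have "vs ! ((j + m) mod ?n) \<in> J" for m
    proof (induction m)
      case 0
      then show ?case
        using assms j by simp
    next
      case (Suc m)
      have "(j + m) mod ?n < ?n"
        using j by (intro mod_less_divisor) linarith
      then have "(vs ! ((j + m) mod ?n), vs ! (Suc ((j + m) mod ?n) mod ?n)) \<in> directed_edges vs"
        unfolding directed_edges_def by blast
      then show ?case
        using closed Suc by (auto simp: mod_Suc_eq)
    qed
    \<comment> \<open>a shift by this amount turns \<open>j\<close> into \<open>k\<close> modulo the length\<close>
    from this[of "?n - j + k"] show False
      using assms j k by simp
  qed
  then show thesis
    using that by blast
qed

lemma increasing_cycle_edge_skips:
  assumes "sorted_wrt (<) vs" "(a, b) \<in> directed_edges vs" "v \<in> set vs"
  shows "\<not> clockwise_between a v b"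
proof -
  let ?n = "length vs"
  obtain j where j: "j < ?n" "a = vs ! j" "b = vs ! (Suc j mod ?n)"
    using assms(2) by (auto simp: directed_edges_def)
  obtain k where k: "k < ?n" "v = vs ! k"
    using assms(3) by (auto simp: in_set_conv_nth)
  have less: "vs ! l < vs ! m \<longleftrightarrow> l < m" if "l < ?n" "m < ?n" for l m
    using sorted_wrt_nth_less[OF assms(1), of l m] sorted_wrt_nth_less[OF assms(1), of m l] that
    by (cases l m rule: linorder_cases) auto
  show ?thesis
    using j k less[of k 0] less[of j k] less[of k "Suc j"] less[of j k] less[of "Suc j" j]
    by (cases "Suc j = ?n") (force simp: clockwise_between_def)+
qed

text \<open>
  Otherwise both \<open>a \<rightarrow> b\<close> and \<open>b \<rightarrow> a\<close> are edges. But a third vertex of the cycle lies on one of the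
  two arcs between \<open>a\<close> and \<open>b\<close>, and an increasing cycle does not skip it.
\<close>

lemma undirected_edge_determines_directed_edge:
  assumes "sorted_wrt (<) vs" "3 \<le> length vs"
    and ab: "(a, b) \<in> directed_edges vs" and cd: "(c, d) \<in> directed_edges vs"
    and eq: "{a, b} = {c, d}"
  shows "(a, b) = (c, d)"
proof (rule ccontr)
  assume "(a, b) \<noteq> (c, d)"
  then have swap: "c = b" "d = a"
    using eq by (auto simp: doubleton_eq_iff)
  have dist: "distinct vs"
    using assms(1) strict_sorted_iff by blast
  have "\<not> set vs \<subseteq> {a, b}"
  proof
    assume "set vs \<subseteq> {a, b}"
    then have "card (set vs) \<le> card {a, b}"
      by (intro card_mono) auto
    also have "\<dots> \<le> 2"
      by (simp add: card_insert_if)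
    finally show False
      using dist assms(2) by (simp add: distinct_card)
  qed
  then obtain v where "v \<in> set vs" "v \<noteq> a" "v \<noteq> b"
    by blast
  then show False
    using increasing_cycle_edge_skips[OF assms(1) ab] increasing_cycle_edge_skips[OF assms(1) cd]
      directed_edge_vertices(3)[OF ab dist assms(2)] clockwise_between_reverse[of a b v] swap
    by blast
qed

section \<open>The linking number as a weighted sum\<close>

text \<open>
  The endpoints of an exterior edge are neighbours on the circle, so no chord with other endpoints
  separates them.
\<close>

lemma crossed_chord_interior:
  assumes "{a, b, c, d} \<subseteq> {1..N}" "distinct [a, b, c, d]" "arc_entry (a, b) (c, d) \<noteq> 0"
  shows "{c, d} \<in> interior_edges N"
proof -
  have "clockwise_between a j b = clockwise_between a (j mod N + 1) b"
    if "j \<in> {1..N}" "a \<noteq> j" "b \<noteq> j" "a \<noteq> j mod N + 1" "b \<noteq> j mod N + 1" for j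
    using that assms(1) by (cases "j = N") (auto simp: clockwise_between_def)
  then have "{c, d} \<notin> exterior_edges N"
    using assms(2,3) by (auto simp: exterior_edges_def doubleton_eq_iff arc_entry_def)
  then show ?thesis
    using assms(1,2) by (auto simp: interior_edges_def edges_def)
qed

lemma interior_edge_arc_nonempty:
  assumes "{a, b} \<in> interior_edges N" "a \<in> {1..N}" "b \<in> {1..N}" "a \<noteq> b"
  obtains v where "v \<in> {1..N}" "clockwise_between a v b"
proof -
  have "b \<noteq> a mod N + 1"
    using assms by (auto simp: interior_edges_def exterior_edges_def)
  then have "a mod N + 1 \<in> {1..N}" "clockwise_between a (a mod N + 1) b"
    using assms(2-4) by (cases "a = N"; auto simp: clockwise_between_def)+
  then show thesis
    using that by blast
qed

lemma interior_directed_edgeD: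
  assumes "(a, b) \<in> interior_directed_edges N vs" "is_cycle N vs"
  shows "(a, b) \<in> directed_edges vs" "{a, b} \<in> interior_edges N" "a \<in> set vs" "b \<in> set vs"
    "a \<in> {1..N}" "b \<in> {1..N}" "a \<noteq> b"
  using assms directed_edge_vertices[of a b vs]
  by (auto simp: interior_directed_edges_def is_cycle_def)

lemma linking_number_eq_weighted_sum:
  assumes circle: "clockwise_on_circle N p"
    and P: "is_cycle N P" and Q: "is_cycle N Q" and disj: "set P \<inter> set Q = {}"
  shows "linking_number N p h P Q
    = (\<Sum>x\<in>interior_directed_edges N P. \<Sum>y\<in>interior_directed_edges N Q.
        arc_entry x y * (if h {fst x, snd x} > h {fst y, snd y} then 1 else -1)) / 2"
proof -
  let ?A = "interior_directed_edges N P" and ?B = "interior_directed_edges N Q"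
  let ?g = "\<lambda>(x, y). arc_entry x y * (if h {fst x, snd x} > h {fst y, snd y} then 1 else -1)"
  have abcd: "{a, b, c, d} \<subseteq> {1..N}" "distinct [a, b, c, d]"
    if "(a, b) \<in> ?A" "(c, d) \<in> ?B" for a b c d
    using interior_directed_edgeD[OF that(1) P] interior_directed_edgeD[OF that(2) Q] disj by auto
  have crossings: "crossings N p P Q = {z \<in> ?A \<times> ?B. arc_entry (fst z) (snd z) \<noteq> 0}"
  proof -
    have "(x, y) \<in> crossings N p P Q \<longleftrightarrow> x \<in> ?A \<and> y \<in> ?B \<and> arc_entry x y \<noteq> 0" for x y
      using chords_meet_iff[OF circle abcd, of "fst x" "snd x" "fst y" "snd y"]
      unfolding crossings_def by (cases x; cases y) (simp, blast)
    then show ?thesis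
      by auto
  qed
  have "(\<Sum>(x, y)\<in>crossings N p P Q. crossing_sign p h x y) = (\<Sum>z\<in>crossings N p P Q. ?g z)"
    using crossing_sign_eq[OF circle abcd] unfolding crossings by (intro sum.cong) auto
  also have "\<dots> = (\<Sum>z\<in>?A \<times> ?B. ?g z)"
    unfolding crossings by (intro sum.mono_neutral_left) (auto simp: finite_interior_directed_edges)
  also have "\<dots> = (\<Sum>x\<in>?A. \<Sum>y\<in>?B. ?g (x, y))"
    by (simp add: sum.cartesian_product)
  finally show ?thesis
    by (simp add: linking_number_def)
qed

lemma interior_directed_edges_rev:
  "interior_directed_edges N (rev vs) = prod.swap ` interior_directed_edges N vs"
  by (force simp: interior_directed_edges_def directed_edges_rev insert_commute)

lemma linking_number_rotate:
  "linking_number N p h (rotate m P) Q = linking_number N p h P Q"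
  "linking_number N p h P (rotate m Q) = linking_number N p h P Q"
  by (simp_all add: linking_number_def crossings_def interior_directed_edges_def directed_edges_rotate)

lemma linking_number_rev:
  assumes circle: "clockwise_on_circle N p"
    and P: "is_cycle N P" and Q: "is_cycle N Q" and disj: "set P \<inter> set Q = {}"
  shows "linking_number N p h (rev P) Q = - linking_number N p h P Q"
    and "linking_number N p h P (rev Q) = - linking_number N p h P Q"
proof -
  have rev: "is_cycle N (rev P)" "is_cycle N (rev Q)"
    using P Q by (simp_all add: is_cycle_def)
  have swap: "arc_entry (prod.swap x) y = - arc_entry x y" "arc_entry x (prod.swap y) = - arc_entry x y"
    if "x \<in> interior_directed_edges N P" "y \<in> interior_directed_edges N Q" for x y
  proof -
    obtain a b c d where xy: "x = (a, b)" "y = (c, d)"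
      by (cases x, cases y)
    have "distinct [a, b, c, d]"
      using interior_directed_edgeD[OF that(1)[unfolded xy] P]
        interior_directed_edgeD[OF that(2)[unfolded xy] Q] disj by auto
    from arc_entry_reverse[OF this]
    show "arc_entry (prod.swap x) y = - arc_entry x y" "arc_entry x (prod.swap y) = - arc_entry x y"
      by (simp_all add: xy)
  qed
  have inj: "inj_on prod.swap X" for X :: "(nat \<times> nat) set"
    by (auto simp: inj_on_def)
  let ?A = "interior_directed_edges N P" and ?B = "interior_directed_edges N Q"
  let ?o = "\<lambda>x y. if h {fst x, snd x} > h {fst y, snd y} then 1 else -1 :: real"
  have "linking_number N p h (rev P) Q
      = (\<Sum>x\<in>?A. \<Sum>y\<in>?B. arc_entry (prod.swap x) y * ?o (prod.swap x) y) / 2"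
    using disj by (subst linking_number_eq_weighted_sum[OF circle rev(1) Q])
      (simp_all add: interior_directed_edges_rev sum.reindex[OF inj])
  also have "\<dots> = (\<Sum>x\<in>?A. \<Sum>y\<in>?B. - (arc_entry x y * ?o x y)) / 2"
    by (intro arg_cong2[where f = "(/)"] sum.cong refl) (simp add: swap insert_commute)
  finally show "linking_number N p h (rev P) Q = - linking_number N p h P Q"
    by (simp add: linking_number_eq_weighted_sum[OF circle P Q disj] sum_negf)
  have "linking_number N p h P (rev Q)
      = (\<Sum>x\<in>?A. \<Sum>y\<in>?B. arc_entry x (prod.swap y) * ?o x (prod.swap y)) / 2"
    using disj by (subst linking_number_eq_weighted_sum[OF circle P rev(2)])
      (simp_all add: interior_directed_edges_rev sum.reindex[OF inj])
  also have "\<dots> = (\<Sum>x\<in>?A. \<Sum>y\<in>?B. - (arc_entry x y * ?o x y)) / 2"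
    by (intro arg_cong2[where f = "(/)"] sum.cong refl) (simp add: swap insert_commute)
  finally show "linking_number N p h P (rev Q) = - linking_number N p h P Q"
    by (simp add: linking_number_eq_weighted_sum[OF circle P Q disj] sum_negf)
qed

section \<open>Crossings of two complementary increasing cycles\<close>

text \<open>
  Exterior edges contribute nothing, so that sums over the interior edges become sums along the
  whole closed curve.
\<close>

lemma sum_arc_entry_interior:
  assumes P: "is_cycle N P" and Q: "is_cycle N Q" and disj: "set P \<inter> set Q = {}"
    and x: "x \<in> interior_directed_edges N P" and f0: "f 0 = (0::real)"
  shows "(\<Sum>y\<in>interior_directed_edges N Q. f (arc_entry x y)) = (\<Sum>y\<in>directed_edges Q. f (arc_entry x y))"
proof (rule sum.mono_neutral_left)
  obtain a b where x_eq: "x = (a, b)"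
    by (cases x)
  have "y \<in> interior_directed_edges N Q" if y: "y \<in> directed_edges Q" "arc_entry x y \<noteq> 0" for y
  proof -
    obtain c d where y_eq: "y = (c, d)"
      by (cases y)
    have "{a, b, c, d} \<subseteq> {1..N}" "distinct [a, b, c, d]"
      using interior_directed_edgeD[OF x[unfolded x_eq] P] directed_edge_vertices[of c d Q] y Q disj
      by (auto simp: y_eq is_cycle_def)
    then have "{c, d} \<in> interior_edges N"
      using crossed_chord_interior y(2) by (simp add: x_eq y_eq)
    then show ?thesis
      using y by (simp add: y_eq interior_directed_edges_def)
  qed
  then show "\<forall>y\<in>directed_edges Q - interior_directed_edges N Q. f (arc_entry x y) = 0"
    using f0 by (metis DiffD1 DiffD2)
qed (auto simp: finite_directed_edges interior_directed_edges_def)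

text \<open>A closed curve enters every arc as often as it leaves it.\<close>

lemma sum_arc_entry_cycle:
  assumes "distinct vs"
  shows "(\<Sum>y\<in>directed_edges vs. arc_entry x y) = 0"
proof -
  obtain a b where "x = (a, b)"
    by (cases x)
  then show ?thesis
    using sum_increments_cycle[OF assms, of "\<lambda>v. of_bool (clockwise_between a v b)"]
    by (simp add: arc_entry_def)
qed

text \<open>
  The arc skipped by an interior edge \<open>a \<rightarrow> b\<close> of \<open>P\<close> contains vertices of \<open>Q\<close> only. Another
  interior edge of \<open>P\<close> skips further vertices of \<open>Q\<close>, so \<open>Q\<close> must leave the arc. It does so once,
  since an increasing cycle leaves an arc of its own vertices only from the last one.
\<close>

lemma two_crossings_on_interior_edge:
  assumes P: "is_cycle N P" "sorted_wrt (<) P" and Q: "is_cycle N Q" "sorted_wrt (<) Q"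
    and cover: "set P \<union> set Q = {1..N}" and disj: "set P \<inter> set Q = {}"
    and x: "x \<in> interior_directed_edges N P"
    and x': "x' \<in> interior_directed_edges N P" "x' \<noteq> x"
  shows "(\<Sum>y\<in>interior_directed_edges N Q. (arc_entry x y)\<^sup>2) = 2"
proof -
  obtain a b where x_eq: "x = (a, b)"
    by (cases x)
  obtain a' b' where x'_eq: "x' = (a', b')"
    by (cases x')
  note ab = interior_directed_edgeD[OF x[unfolded x_eq] P(1)]
  note ab' = interior_directed_edgeD[OF x'(1)[unfolded x'_eq] P(1)]
  have dist: "distinct P" "distinct Q" and Q_len: "3 \<le> length Q"
    using P(1) Q(1) by (auto simp: is_cycle_def)
  define J where "J = {v. clockwise_between a v b}"
  have P_skip: "\<not> clockwise_between a v b" "\<not> clockwise_between a' v b'" if "v \<in> set P" for v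
    using increasing_cycle_edge_skips[OF P(2)] ab(1) ab'(1) that by auto
  have Q_skip: "\<not> clockwise_between c v d" if "(c, d) \<in> directed_edges Q" "v \<in> set Q" for c d v
    using increasing_cycle_edge_skips[OF Q(2)] that by auto
  obtain v where v: "v \<in> set Q" "v \<in> J"
    using interior_edge_arc_nonempty[OF ab(2,5,6,7)] P_skip(1) cover unfolding J_def by blast
  obtain w where w: "w \<in> {1..N}" "clockwise_between a' w b'"
    using interior_edge_arc_nonempty[OF ab'(2,5,6,7)] by blast
  have w_Q: "w \<in> set Q"
    using w P_skip(2) cover by blast
  have "w \<notin> J"
  proof
    assume "w \<in> J"
    then have "a = a' \<and> b = b'"
      using meeting_arcs_equal w(2) P_skip(1)[OF ab'(3)] P_skip(1)[OF ab'(4)]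
        P_skip(2)[OF ab(3)] P_skip(2)[OF ab(4)] unfolding J_def by blast
    then show False
      using x'(2) x_eq x'_eq by simp
  qed
  then obtain c d where cd: "(c, d) \<in> directed_edges Q" "c \<in> J" "d \<notin> J"
    using cycle_leaves_set[OF v w_Q] by blast
  have exit_unique: "(c', d') = (c, d)"
    if cd': "(c', d') \<in> directed_edges Q" "c' \<in> J" "d' \<notin> J" for c' d'
  proof -
    note vert = directed_edge_vertices[OF cd(1) dist(2) Q_len] directed_edge_vertices[OF cd'(1) dist(2) Q_len]
    have "c' = c"
    proof (rule ccontr)
      assume "c' \<noteq> c"
      moreover have "a \<noteq> c" "a \<noteq> c'"
        using vert ab(3) disj by auto
      ultimately have "clockwise_between a c c' \<or> clockwise_between a c' c"
        using clockwise_between_total[of c a c'] by simp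
      then have "clockwise_between c c' d \<or> clockwise_between c' c d'"
        using cd(2,3) cd'(2,3) clockwise_between_exit unfolding J_def by blast
      then show False
        using Q_skip cd(1) cd'(1) vert by blast
    qed
    then show ?thesis
      using directed_edge_out_unique[OF cd'(1) _ dist(2)] cd(1) by simp
  qed
  define leaves where "leaves y = (of_bool (fst y \<in> J \<and> snd y \<notin> J) :: real)" for y
  have "leaves y = (if y = (c, d) then 1 else 0)" if "y \<in> directed_edges Q" for y
    using exit_unique[of "fst y" "snd y"] that cd(2,3) by (cases "y = (c, d)") (auto simp: leaves_def)
  then have one: "(\<Sum>y\<in>directed_edges Q. leaves y) = 1"
    using cd(1) by (simp add: finite_directed_edges)
  \<comment> \<open>the square is \<open>1\<close> for an entrance and for an exit, while \<open>arc_entry\<close> is \<open>1\<close> and \<open>-1\<close>\<close>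
  have "(\<Sum>y\<in>directed_edges Q. (arc_entry x y)\<^sup>2) = (\<Sum>y\<in>directed_edges Q. arc_entry x y + 2 * leaves y)"
    by (intro sum.cong refl) (auto simp: leaves_def J_def x_eq arc_entry_def)
  also have "\<dots> = 2"
    using one by (simp add: sum.distrib sum_distrib_left[symmetric] sum_arc_entry_cycle[OF dist(2)])
  finally show ?thesis
    using sum_arc_entry_interior[OF P(1) Q(1) disj x, of "\<lambda>t. t\<^sup>2"] by simp
qed

text \<open>
  The sign of a comparison is attached to the numbers of the two sheets, and the second moment
  formula applies because distinct edges, of the same cycle or of different ones, have distinct
  sheets.
\<close>

lemma mean_squared_linking_number_increasing:
  assumes circle: "clockwise_on_circle N p"
    and e: "bij_betw e {1..num_interior_edges N} (interior_edges N)"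
    and P: "is_cycle N P" "sorted_wrt (<) P" and Q: "is_cycle N Q" "sorted_wrt (<) Q"
    and cover: "set P \<union> set Q = {1..N}" and disj: "set P \<inter> set Q = {}"
    and not_one: "card (interior_directed_edges N P) \<noteq> 1"
  shows "mean_squared_linking_number N p e P Q = card (interior_directed_edges N P) / 6"
proof -
  let ?A = "interior_directed_edges N P" and ?B = "interior_directed_edges N Q"
  define S where "S = {1..num_interior_edges N}"
  define \<iota> where "\<iota> = (\<lambda>(a, b). inv_into S e {a, b})"
  have e_inj: "inj_on e S" and e_img: "e ` S = interior_edges N"
    using e by (auto simp: bij_betw_def S_def)
  have fin: "finite S" "finite ?A" "finite ?B"
    by (simp_all add: S_def finite_interior_directed_edges)
  have \<iota>_eq: "\<iota> x = \<iota> y \<longleftrightarrow> {fst x, snd x} = {fst y, snd y}" and \<iota>_mem: "\<iota> x \<in> S"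
    if "x \<in> ?A \<union> ?B" "y \<in> ?A \<union> ?B" for x y
  proof -
    have "{fst x, snd x} \<in> e ` S" "{fst y, snd y} \<in> e ` S"
      using that unfolding e_img by (auto simp: interior_directed_edges_def)
    then show "\<iota> x = \<iota> y \<longleftrightarrow> {fst x, snd x} = {fst y, snd y}" "\<iota> x \<in> S"
      using inv_into_injective[of S e] inv_into_into[of _ e S]
      by (auto simp: \<iota>_def split_beta)
  qed
  have inj: "inj_on \<iota> ?A" "inj_on \<iota> ?B"
    using undirected_edge_determines_directed_edge[OF P(2)] undirected_edge_determines_directed_edge[OF Q(2)]
      P(1) Q(1) \<iota>_eq by (auto simp: inj_on_def interior_directed_edges_def is_cycle_def)
  have range: "\<iota> ` ?A \<subseteq> S" "\<iota> ` ?B \<subseteq> S"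
    using \<iota>_mem by auto
  have sep: "\<iota> ` ?A \<inter> \<iota> ` ?B = {}"
  proof -
    have "\<iota> x \<noteq> \<iota> y" if "x \<in> ?A" "y \<in> ?B" for x y
      using that \<iota>_eq[of x y] interior_directed_edgeD[of "fst x" "snd x", OF _ P(1)]
        interior_directed_edgeD[of "fst y" "snd y", OF _ Q(1)] disj
      by (auto simp: doubleton_eq_iff)
    then show ?thesis
      by blast
  qed
  have linking: "linking_number N p (sheet_height N e \<sigma>) P Q
      = (\<Sum>x\<in>?A. \<Sum>y\<in>?B. arc_entry x y / 2 * height_sign \<sigma> (\<iota> x) (\<iota> y))" for \<sigma>
    unfolding linking_number_eq_weighted_sum[OF circle P(1) Q(1) disj] sum_divide_distrib
    by (intro sum.cong refl) (simp add: sheet_height_def height_sign_def \<iota>_def S_def split_beta)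
  have rows: "(\<Sum>y\<in>?B. arc_entry x y) = 0" if "x \<in> ?A" for x
    using sum_arc_entry_interior[OF P(1) Q(1) disj that, of "\<lambda>t. t"] sum_arc_entry_cycle[of Q x] Q(1)
    by (simp add: is_cycle_def)
  have cols: "(\<Sum>x\<in>?A. arc_entry x y) = 0" if y: "y \<in> ?B" for y
  proof -
    have "arc_entry x y = - arc_entry y x" if x: "x \<in> ?A" for x
    proof -
      obtain a b c d where xy: "x = (a, b)" "y = (c, d)"
        by (cases x, cases y)
      have "distinct [c, d, a, b]"
        using interior_directed_edgeD[OF x[unfolded xy] P(1)]
          interior_directed_edgeD[OF y[unfolded xy] Q(1)] disj by auto
      then show ?thesis
        unfolding xy by (rule arc_entry_swap)
    qed
    then have "(\<Sum>x\<in>?A. arc_entry x y) = - (\<Sum>x\<in>?A. arc_entry y x)"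
      by (simp add: sum_negf[symmetric] cong: sum.cong)
    also have "\<dots> = 0"
      using sum_arc_entry_interior[OF Q(1) P(1) _ y, of "\<lambda>t. t"] sum_arc_entry_cycle[of P y] P(1) disj
      by (simp add: is_cycle_def Int_commute)
    finally show ?thesis .
  qed
  have squares: "(\<Sum>y\<in>?B. (arc_entry x y)\<^sup>2) = 2" if x: "x \<in> ?A" for x
  proof -
    obtain x' where "x' \<in> ?A" "x' \<noteq> x"
      using x not_one by (metis card_1_singleton_iff is_singletonI' is_singleton_def empty_iff One_nat_def)
    then show ?thesis
      using two_crossings_on_interior_edge[OF P Q cover disj x] by blast
  qed
  have "mean_squared_linking_number N p e P Q
      = permutation_mean S (\<lambda>\<sigma>. (\<Sum>x\<in>?A. \<Sum>y\<in>?B. arc_entry x y / 2 * height_sign \<sigma> (\<iota> x) (\<iota> y))\<^sup>2)"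
    unfolding mean_squared_linking_number_def permutation_mean_def linking S_def ..
  also have "\<dots> = ((\<Sum>x\<in>?A. (\<Sum>y\<in>?B. arc_entry x y / 2)\<^sup>2) + (\<Sum>y\<in>?B. (\<Sum>x\<in>?A. arc_entry x y / 2)\<^sup>2)
      + (\<Sum>x\<in>?A. \<Sum>y\<in>?B. (arc_entry x y / 2)\<^sup>2)) / 3"
    by (rule second_moment_of_comparisons[OF fin inj(1) range(1) inj(2) range(2) sep])
  also have "\<dots> = card ?A / 6"
    by (simp add: sum_divide_distrib[symmetric] rows cols power_divide squares)
  finally show ?thesis .
qed

section \<open>Monotonic cycles\<close>

text \<open>
  Starting point and orientation do not affect the square of the linking number, so every
  monotonic cycle may be listed in increasing order.
\<close>

lemma monotonic_cycle_sorted: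
  assumes "monotonic_cycle vs"
  obtains m ws where "sorted_wrt (<) ws" "ws = rotate m vs \<or> ws = rev (rotate m vs)"
proof -
  from assms consider m where "successively (<) (rotate m vs)" | m where "successively (>) (rotate m vs)"
    unfolding monotonic_cycle_def strictly_increasing_cycle_def strictly_decreasing_cycle_def by blast
  then show thesis
  proof cases
    case (1 m)
    then show thesis
      using that[of "rotate m vs" m] by (simp add: successively_conv_sorted_wrt)
  next
    case (2 m)
    then have "sorted_wrt (<) (rev (rotate m vs))"
      by (subst successively_conv_sorted_wrt[symmetric]) simp_all
    then show thesis
      using that by blast
  qed
qed

theorem theorem10:
  fixes n i :: nat and p :: "nat \<Rightarrow> complex" and e :: "nat \<Rightarrow> nat set" and P Q :: "nat list"
  assumes "clockwise_on_circle (2 * n) p"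
    and "bij_betw e {1..num_interior_edges (2 * n)} (interior_edges (2 * n))"
    and "is_cycle (2 * n) P" and "length P = n" and "monotonic_cycle P"
    and "is_cycle (2 * n) Q" and "length Q = n" and "monotonic_cycle Q"
    and "set P \<inter> set Q = {}"
    and "card (interior_directed_edges (2 * n) P) = i"
    and "card (interior_directed_edges (2 * n) Q) = i"
    and "i \<noteq> 1"
  shows "mean_squared_linking_number (2 * n) p e P Q = real i / 6"
proof -
  let ?N = "2 * n"
  obtain m P' where P': "sorted_wrt (<) P'" "P' = rotate m P \<or> P' = rev (rotate m P)"
    using monotonic_cycle_sorted[OF assms(5)] by blast
  obtain k Q' where Q': "sorted_wrt (<) Q'" "Q' = rotate k Q \<or> Q' = rev (rotate k Q)"
    using monotonic_cycle_sorted[OF assms(8)] by blast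
  have cyc: "is_cycle ?N (rotate m P)" "is_cycle ?N (rotate k Q)" "is_cycle ?N P'" "is_cycle ?N Q'"
    using P'(2) Q'(2) assms(3,6) by (auto simp: is_cycle_def)
  have sets: "set P' = set P" "set Q' = set Q"
    using P'(2) Q'(2) by auto
  have cover: "set P' \<union> set Q' = {1..?N}"
  proof (rule card_subset_eq)
    show "set P' \<union> set Q' \<subseteq> {1..?N}"
      using cyc by (auto simp: is_cycle_def)
    show "card (set P' \<union> set Q') = card {1..?N}"
      using assms(3,4,6,7,9) by (simp add: sets card_Un_disjoint distinct_card is_cycle_def)
  qed simp
  have disj: "set P' \<inter> set Q' = {}" "set P' \<inter> set (rotate k Q) = {}" "set (rotate m P) \<inter> set (rotate k Q) = {}"
    using assms(9) sets by auto
  have "(linking_number ?N p h P' Q')\<^sup>2 = (linking_number ?N p h P Q)\<^sup>2" for h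
  proof -
    have "(linking_number ?N p h P' Q')\<^sup>2 = (linking_number ?N p h P' (rotate k Q))\<^sup>2"
      using Q'(2) linking_number_rev(2)[OF assms(1) cyc(3,2) disj(2)] by auto
    also have "\<dots> = (linking_number ?N p h (rotate m P) (rotate k Q))\<^sup>2"
      using P'(2) linking_number_rev(1)[OF assms(1) cyc(1,2) disj(3)] by auto
    finally show ?thesis
      by (simp add: linking_number_rotate)
  qed
  then have "mean_squared_linking_number ?N p e P Q = mean_squared_linking_number ?N p e P' Q'"
    by (simp add: mean_squared_linking_number_def)
  moreover have "card (interior_directed_edges ?N P') = i"
  proof -
    have rot: "interior_directed_edges ?N (rotate m P) = interior_directed_edges ?N P"
      by (simp add: interior_directed_edges_def directed_edges_rotate)
    have "card (prod.swap ` X) = card X" for X :: "(nat \<times> nat) set"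
      by (intro card_image) (auto simp: inj_on_def)
    then show ?thesis
      using P'(2) rot assms(10) by (auto simp: interior_directed_edges_rev)
  qed
  ultimately show ?thesis
    using mean_squared_linking_number_increasing[OF assms(1,2) cyc(3) P'(1) cyc(4) Q'(1) cover disj(1)]
      assms(12) by simp
qed

end
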